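(* Let $k\ge 2$ and let $\varphi_k:(\mathbb{K}^{2k-2},0)\to(\mathbb{K}^{2k-1},0)$ be the minimal cross cap mapping of multiplicity $k$. For each $j$ with $1\le j\le k-1$, the vector field $\xi^3_j$ on $(\mathbb{K}^{2k-1},0)$ whose components are \[ \xi^3_j=(A^3_{1,j},\dots,A^3_{k-2,j},B^3_{1,j},\dots,B^3_{k-1,j},C^3_{1,j},C^3_{2,j})^T \] with \begin{align*} A_{i,j}^3&=-k(k+i-j+1)U_{k+i-j+1}W_2+k\sum_{r=1}^i(k+i-j-r+1)U_{k+i-j-r+1}V_r\\ &\quad-k\sum_{r=1}^irU_rV_{k+i-j-r+1}-k(i+1)U_{i+1}V_{k-j}, && 1\le i\le k-2,\\ B_{i,j}^3&=-k(k+i-j+1)V_{k+i-j+1}W_2+k\sum_{r=1}^i(k+i-j-2r+1)V_rV_{k+i-j-r+1}\\ &\quad-k(i+1)V_{i+1}V_{k-j}, && 1\le i\le k-1,\\ C_{1,j}^3&=k(k-j+1)U_{k-j+1}W_2+kU_1V_{k-j},\\ C_{2,j}^3&=k(k-j+1)V_{k-j+1}W_2+kV_1V_{k-j} \end{align*} is liftable over $\varphi_k$.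
   Context: $\mathbb{K}=\mathbb{R}$ or $\mathbb{C}$; maps, functions and vector fields are germs that are smooth (infinitely differentiable) or $\mathbb{K}$-analytic. The minimal cross cap mapping of multiplicity $k\ge2$ is $\varphi_k:(\mathbb{K}^{2k-2},0)\to(\mathbb{K}^{2k-1},0)$, \[ \varphi_k(u_1,\ldots,u_{k-2},v_1,\ldots,v_{k-1},y)=\Big(u_1,\ldots,u_{k-2},v_1,\ldots,v_{k-1},\,y^k+\sum_{i=1}^{k-2}u_iy^i,\ \sum_{i=1}^{k-1}v_iy^i\Big). \] The coordinates on the target are, in order, $U_1,\dots,U_{k-2},V_1,\dots,V_{k-1},W_1,W_2$; components of vector fields are listed in this order. Dummy variable convention: $U_{k-1}=V_k=0$, $U_k=1$, and $U_r=V_r=0$ for $r\le 0$ and for $r>k$. Empty sums are $0$. A vector field germ $\xi$ on $(\mathbb{K}^p,0)$ is liftable over $f:(\mathbb{K}^n,0)\to(\mathbb{K}^p,0)$ if there is a vector field germ $\eta$ on $(\mathbb{K}^n,0)$ with $df\circ\eta=\xi\circ f$, i.e. (writing vector fields as column vectors of functions and $J_f$ for the Jacobian matrix) $J_f\,\eta=\xi\circ f$. *)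

theory Defs
  imports "HOL-Analysis.Analysis"
begin

text \<open>
  The field \<open>\<bbbK>\<close> is a type of class \<^class>\<open>real_normed_field\<close>, to be instantiated to
  \<^typ>\<open>real\<close> or \<^typ>\<open>complex\<close>. A germ at the origin is given by a total representative; only
  its behaviour near 0 matters.
\<close>

text \<open>
  On \<^typ>\<open>complex\<close>-spaces the library's Frechet derivative is only real-linear, so
  \<open>\<bbbK>\<close>-differentiability additionally requires the derivative to commute with scalars of \<open>\<bbbK>\<close>.
\<close>

definition K_differentiable_on ::
    "('a::real_normed_field ^ 'n::finite) set \<Rightarrow> ('a ^ 'n \<Rightarrow> 'a ^ 'm::finite) \<Rightarrow> bool" where
  "K_differentiable_on S f \<longleftrightarrow>
     (\<forall>x\<in>S. f differentiable (at x) \<and>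
        (\<forall>c v. frechet_derivative f (at x) (c *s v) = c *s frechet_derivative f (at x) v))"

text \<open>\<open>C\<^sup>n\<close> over \<open>\<bbbK>\<close> on an open set: all derivatives up to order \<open>n\<close> exist and are continuous.\<close>

primrec K_Cn_on ::
    "nat \<Rightarrow> ('a::real_normed_field ^ 'n::finite) set \<Rightarrow> ('a ^ 'n \<Rightarrow> 'a ^ 'm::finite) \<Rightarrow> bool" where
  "K_Cn_on 0 S f \<longleftrightarrow> continuous_on S f"
| "K_Cn_on (Suc n) S f \<longleftrightarrow>
     K_differentiable_on S f \<and> (\<forall>v. K_Cn_on n S (\<lambda>x. frechet_derivative f (at x) v))"

definition K_smooth_on ::
    "('a::real_normed_field ^ 'n::finite) set \<Rightarrow> ('a ^ 'n \<Rightarrow> 'a ^ 'm::finite) \<Rightarrow> bool" where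
  "K_smooth_on S f \<longleftrightarrow> (\<forall>n. K_Cn_on n S f)"

text \<open>
  \<open>\<bbbK>\<close>-analyticity: near each point of \<open>S\<close> the map is the sum of a convergent power series in
  several variables; the functions \<open>\<alpha> :: 'n \<Rightarrow> nat\<close> are the multi-indices.
\<close>

definition K_analytic_on ::
    "('a::real_normed_field ^ 'n::finite) set \<Rightarrow> ('a ^ 'n \<Rightarrow> 'a ^ 'm::finite) \<Rightarrow> bool" where
  "K_analytic_on S f \<longleftrightarrow>
     (\<forall>a\<in>S. \<exists>(c :: ('n \<Rightarrow> nat) \<Rightarrow> 'a ^ 'm) r. r > 0 \<and>
        (\<forall>x\<in>ball a r. ((\<lambda>\<alpha>. (\<Prod>i\<in>UNIV. (x $ i - a $ i) ^ \<alpha> i) *s c \<alpha>) has_sum f x) UNIV))"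

datatype regularity = Smooth | Analytic

fun regular_on ::
    "regularity \<Rightarrow> ('a::real_normed_field ^ 'n::finite) set \<Rightarrow> ('a ^ 'n \<Rightarrow> 'a ^ 'm::finite) \<Rightarrow> bool"
  where
  "regular_on Smooth S f = K_smooth_on S f"
| "regular_on Analytic S f = K_analytic_on S f"

definition regular_germ ::
    "regularity \<Rightarrow> ('a::real_normed_field ^ 'n::finite \<Rightarrow> 'a ^ 'm::finite) \<Rightarrow> bool" where
  "regular_germ reg f \<longleftrightarrow> (\<exists>S. open S \<and> 0 \<in> S \<and> regular_on reg S f)"

definition map_germ ::
    "regularity \<Rightarrow> ('a::real_normed_field ^ 'n::finite \<Rightarrow> 'a ^ 'm::finite) \<Rightarrow> bool" where
  "map_germ reg f \<longleftrightarrow> regular_germ reg f \<and> f 0 = 0"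

text \<open>A vector field germ at the origin need not vanish there.\<close>

definition vector_field_germ ::
    "regularity \<Rightarrow> ('a::real_normed_field ^ 'n::finite \<Rightarrow> 'a ^ 'n) \<Rightarrow> bool" where
  "vector_field_germ reg \<xi> \<longleftrightarrow> regular_germ reg \<xi>"

definition liftable ::
    "regularity \<Rightarrow> ('a::real_normed_field ^ 'n::finite \<Rightarrow> 'a ^ 'm::finite) \<Rightarrow>
      ('a ^ 'm \<Rightarrow> 'a ^ 'm) \<Rightarrow> bool" where
  "liftable reg f \<xi> \<longleftrightarrow>
     map_germ reg f \<and> vector_field_germ reg \<xi> \<and>
     (\<exists>\<eta>. vector_field_germ reg \<eta> \<and>
        (\<forall>\<^sub>F x in nhds 0. frechet_derivative f (at x) (\<eta> x) = \<xi> (f x)))"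

text \<open>
  Ordered coordinates: a space of dimension \<open>d\<close> is \<open>'a ^ 'n\<close> together with a bijection
  \<open>e\<close> from \<open>{..<d}\<close> to the index type, so that \<open>x $ e p\<close> is the coordinate of \<open>x\<close> at
  position \<open>p\<close>, counted from 0.
\<close>

definition vec_of_list :: "(nat \<Rightarrow> 'n::finite) \<Rightarrow> 'a list \<Rightarrow> 'a ^ 'n" where
  "vec_of_list e xs = (\<chi> c. xs ! inv_into {..<length xs} e c)"

text \<open>Source coordinates \<open>u\<^sub>1, \<dots>, u\<^bsub>k-2\<^esub>, v\<^sub>1, \<dots>, v\<^bsub>k-1\<^esub>, y\<close>.\<close>

definition min_cross_cap ::
    "nat \<Rightarrow> (nat \<Rightarrow> 'n::finite) \<Rightarrow> (nat \<Rightarrow> 'm::finite) \<Rightarrow> 'a::comm_ring_1 ^ 'n \<Rightarrow> 'a ^ 'm" where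
  "min_cross_cap k s t x =
     (let u = (\<lambda>i. x $ s (i - 1));
          v = (\<lambda>i. x $ s (k - 2 + (i - 1)));
          y = x $ s (2 * k - 3)
      in vec_of_list t
           (map u [1..<k - 1] @ map v [1..<k] @
            [y ^ k + (\<Sum>i=1..k - 2. u i * y ^ i), \<Sum>i=1..k - 1. v i * y ^ i]))"

text \<open>
  Target coordinates \<open>U\<^sub>1, \<dots>, U\<^bsub>k-2\<^esub>, V\<^sub>1, \<dots>, V\<^bsub>k-1\<^esub>, W\<^sub>1, W\<^sub>2\<close>. The indices of \<open>U\<close>
  and \<open>V\<close> are integers and obey the dummy variable convention \<open>U\<^bsub>k-1\<^esub> = V\<^sub>k = 0\<close>, \<open>U\<^sub>k = 1\<close>,
  \<open>U\<^sub>r = V\<^sub>r = 0\<close> for \<open>r \<le> 0\<close> and for \<open>r > k\<close>.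
\<close>

definition U_coord :: "nat \<Rightarrow> (nat \<Rightarrow> 'm::finite) \<Rightarrow> 'a::comm_ring_1 ^ 'm \<Rightarrow> int \<Rightarrow> 'a" where
  "U_coord k t X r =
     (if 1 \<le> r \<and> r \<le> int k - 2 then X $ t (nat r - 1) else if r = int k then 1 else 0)"

definition V_coord :: "nat \<Rightarrow> (nat \<Rightarrow> 'm::finite) \<Rightarrow> 'a::comm_ring_1 ^ 'm \<Rightarrow> int \<Rightarrow> 'a" where
  "V_coord k t X r = (if 1 \<le> r \<and> r \<le> int k - 1 then X $ t (k - 2 + (nat r - 1)) else 0)"

definition W2_coord :: "nat \<Rightarrow> (nat \<Rightarrow> 'm::finite) \<Rightarrow> 'a ^ 'm \<Rightarrow> 'a" where
  "W2_coord k t X = X $ t (2 * k - 2)"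

definition A3 ::
    "int \<Rightarrow> (int \<Rightarrow> 'a::comm_ring_1) \<Rightarrow> (int \<Rightarrow> 'a) \<Rightarrow> 'a \<Rightarrow> int \<Rightarrow> int \<Rightarrow> 'a" where
  "A3 k U V W2 i j =
     - of_int k * of_int (k + i - j + 1) * U (k + i - j + 1) * W2
     + of_int k * (\<Sum>r=1..i. of_int (k + i - j - r + 1) * U (k + i - j - r + 1) * V r)
     - of_int k * (\<Sum>r=1..i. of_int r * U r * V (k + i - j - r + 1))
     - of_int k * of_int (i + 1) * U (i + 1) * V (k - j)"

definition B3 :: "int \<Rightarrow> (int \<Rightarrow> 'a::comm_ring_1) \<Rightarrow> 'a \<Rightarrow> int \<Rightarrow> int \<Rightarrow> 'a" where
  "B3 k V W2 i j =
     - of_int k * of_int (k + i - j + 1) * V (k + i - j + 1) * W2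
     + of_int k * (\<Sum>r=1..i. of_int (k + i - j - 2 * r + 1) * V r * V (k + i - j - r + 1))
     - of_int k * of_int (i + 1) * V (i + 1) * V (k - j)"

definition C3_1 ::
    "int \<Rightarrow> (int \<Rightarrow> 'a::comm_ring_1) \<Rightarrow> (int \<Rightarrow> 'a) \<Rightarrow> 'a \<Rightarrow> int \<Rightarrow> 'a" where
  "C3_1 k U V W2 j =
     of_int k * of_int (k - j + 1) * U (k - j + 1) * W2 + of_int k * U 1 * V (k - j)"

definition C3_2 :: "int \<Rightarrow> (int \<Rightarrow> 'a::comm_ring_1) \<Rightarrow> 'a \<Rightarrow> int \<Rightarrow> 'a" where
  "C3_2 k V W2 j =
     of_int k * of_int (k - j + 1) * V (k - j + 1) * W2 + of_int k * V 1 * V (k - j)"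

definition xi3 ::
    "nat \<Rightarrow> (nat \<Rightarrow> 'm::finite) \<Rightarrow> nat \<Rightarrow> 'a::comm_ring_1 ^ 'm \<Rightarrow> 'a ^ 'm" where
  "xi3 k t j X =
     (let U = U_coord k t X; V = V_coord k t X; W2 = W2_coord k t X
      in vec_of_list t
           (map (\<lambda>i. A3 (int k) U V W2 i (int j)) [1..int k - 2] @
            map (\<lambda>i. B3 (int k) V W2 i (int j)) [1..int k - 1] @
            [C3_1 (int k) U V W2 (int j), C3_2 (int k) V W2 (int j)]))"

end

theory Submission
  imports Defs
begin

text \<open>
  Let \<open>m = k - j\<close>, \<open>p(y) = \<Sum>\<^sub>r U\<^sub>r y\<^sup>r\<close> and \<open>q(y) = \<Sum>\<^sub>r V\<^sub>r y\<^sup>r\<close>, so that \<open>W\<^sub>1 = p(y)\<close> and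
  \<open>W\<^sub>2 = q(y)\<close> along the map. A lift has to copy the \<open>A\<close>- and \<open>B\<close>-components, so only its
  \<open>y\<close>-component is unknown; it is \<open>k h\<close> with \<open>h = \<Sum>\<^sub>l\<^sub>\<ge>\<^sub>m V\<^sub>l y\<^bsup>l-m\<^esup>\<close>. Up to the factors \<open>-k\<close> and
  \<open>k\<close>, the \<open>A\<^sub>i\<close> and \<open>C\<^sub>1\<close> are the values for \<open>i \<ge> 1\<close> and \<open>i = 0\<close> of one bracket built from \<open>r U\<^sub>r\<close>
  and \<open>V\<^sub>r\<close>, and similarly for \<open>B\<^sub>i\<close> and \<open>C\<^sub>2\<close>. The two equations left to check thus say that the
  generating polynomials of the brackets are \<open>p' h\<close> and \<open>q' h\<close>. Their sums are truncations of
  products of polynomials, and the parts cut off cancel by the symmetry \<open>r \<leftrightarrow> l\<close>.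
\<close>

subsection \<open>The polynomial identity\<close>

text \<open>\<open>P r\<close> will be \<open>r\<close> times \<open>U r\<close> or
  \<open>V r\<close>, \<open>Q\<close> will be \<open>V\<close>, and \<open>m\<close> is
  \<open>k - j\<close>. The value \<open>w\<close> of \<open>W_2\<close> stays a free argument, so
  the components of the field can be rewritten on the whole target, before \<open>w\<close> becomes
  a polynomial in \<open>y\<close>.\<close>

definition lift_bracket :: "(int \<Rightarrow> 'a::comm_ring_1) \<Rightarrow> (int \<Rightarrow> 'a) \<Rightarrow> 'a \<Rightarrow> int \<Rightarrow> int \<Rightarrow> 'a" where
  "lift_bracket P Q w m i = P (m + i + 1) * w - (\<Sum>r=1..i. P (m + i + 1 - r) * Q r)
     + (\<Sum>r=1..i. P r * Q (m + i + 1 - r)) + P (i + 1) * Q m"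

text \<open>The substitution \<open>l = m + i + 1 - r\<close> turns \<open>r \<le> i\<close> into
  \<open>m + 1 \<le> l\<close> and \<open>i \<le> k - 1\<close> into
  \<open>l + r \<le> m + k\<close>.\<close>

lemma triangle_sum:
  fixes F :: "int \<Rightarrow> int \<Rightarrow> 'a::comm_ring_1"
  shows "(\<Sum>i=0..k - 1. \<Sum>r=1..i. F r (m + i + 1 - r)) =
    (\<Sum>(r, l)\<in>{(r, l). 1 \<le> r \<and> m + 1 \<le> l \<and> l + r \<le> m + k}. F r l)"
proof -
  have "(\<Sum>i=0..k - 1. \<Sum>r=1..i. F r (m + i + 1 - r)) =
      (\<Sum>(i, r)\<in>(SIGMA i:{0..k - 1}. {1..i}). F r (m + i + 1 - r))"
    by (subst sum.Sigma) auto
  also have "\<dots> = (\<Sum>(r, l)\<in>{(r, l). 1 \<le> r \<and> m + 1 \<le> l \<and> l + r \<le> m + k}. F r l)"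
    by (rule sum.reindex_bij_witness[where i = "\<lambda>(r, l). (l + r - m - 1, r)"
          and j = "\<lambda>(i, r). (r, m + i + 1 - r)"]) auto
  finally show ?thesis .
qed

text \<open>The line \<open>l + r = m + k\<close> cuts the box into the triangle of the truncated
  sums and a corner. In the corner, \<open>l \<le> k\<close> forces \<open>r \<ge> m + 1\<close>, so
  it lies in a square and is symmetric in \<open>r\<close> and \<open>l\<close>.\<close>

lemma box_sum_split:
  fixes F :: "int \<Rightarrow> int \<Rightarrow> 'a::comm_ring_1"
  assumes F: "\<And>r l. l > k \<Longrightarrow> F r l = 0" and m: "0 \<le> m"
  shows "(\<Sum>r=1..k. \<Sum>l=m + 1..k. F r l) = (\<Sum>i=0..k - 1. \<Sum>r=1..i. F r (m + i + 1 - r))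
     + (\<Sum>r=m + 1..k. \<Sum>l=m + 1..k. if l + r > m + k then F r l else 0)"
proof -
  let ?R = "{(r, l). 1 \<le> r \<and> m + 1 \<le> l \<and> l + r \<le> m + k}"
  let ?T = "{(r, l). r \<in> {m + 1..k} \<and> l \<in> {m + 1..k} \<and> l + r > m + k}"
  have finR: "finite ?R"
    by (rule finite_subset[of _ "{1..k} \<times> {m + 1..m + k}"]) auto
  have finT: "finite ?T"
    by (rule finite_subset[of _ "{m + 1..k} \<times> {m + 1..k}"]) auto
  have "(\<Sum>r=1..k. \<Sum>l=m + 1..k. F r l) = (\<Sum>(r, l)\<in>{1..k} \<times> {m + 1..k}. F r l)"
    by (simp add: sum.cartesian_product)
  \<comment> \<open>The union covers the box; its points outside the box have \<open>l > k\<close>,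
    where \<open>F\<close> vanishes.\<close>
  also have "\<dots> = (\<Sum>(r, l)\<in>?R \<union> ?T. F r l)"
    using finR finT m by (intro sum.mono_neutral_left) (auto intro: F)
  also have "\<dots> = (\<Sum>(r, l)\<in>?R. F r l) + (\<Sum>(r, l)\<in>?T. F r l)"
    using finR finT by (intro sum.union_disjoint) auto
  also have "(\<Sum>(r, l)\<in>?T. F r l) =
      (\<Sum>(r, l)\<in>{m + 1..k} \<times> {m + 1..k}. if l + r > m + k then F r l else 0)"
    by (rule sum.mono_neutral_cong_left) (auto split: if_splits)
  also have "\<dots> = (\<Sum>r=m + 1..k. \<Sum>l=m + 1..k. if l + r > m + k then F r l else 0)"
    by (simp add: sum.cartesian_product)
  finally show ?thesis
    by (simp add: triangle_sum)
qed

text \<open>The first sum in the bracket is a truncation of \<open>w\<close> times the tail of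
  \<open>P\<close>, the second a truncation of the product of \<open>P\<close> with the tail of
  \<open>Q\<close>. Both lose the same corner, so their difference is that of the full products; the
  \<open>w\<close>-term of the bracket then cancels the first product, and the term with
  \<open>Q m\<close> completes the second.\<close>

lemma sum_lift_bracket:
  fixes P Q :: "int \<Rightarrow> 'a::comm_ring_1"
  assumes P: "\<And>r. r > k \<Longrightarrow> P r = 0" and Q: "\<And>r. r > k \<Longrightarrow> Q r = 0"
    and m: "1 \<le> m" "m \<le> k"
  shows "(\<Sum>i=0..k - 1. y ^ nat i * lift_bracket P Q (\<Sum>r=1..k. Q r * y ^ nat r) m i) =
    (\<Sum>r=1..k. P r * y ^ nat (r - 1)) * (\<Sum>l=m..k. Q l * y ^ nat (l - m))"
proof -
  define g where "g = (\<Sum>r=1..k. Q r * y ^ nat r)"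
  define p where "p = (\<Sum>r=1..k. P r * y ^ nat (r - 1))"
  \<comment> \<open>On \<open>l = m + i + 1 - r\<close> this weight equals \<open>y ^ nat i\<close>,
    and it is symmetric in \<open>r\<close> and \<open>l\<close>. Hence \<open>F1\<close> and
    \<open>F2\<close> are exchanged by swapping their arguments.\<close>
  define e where "e = (\<lambda>r l. y ^ nat (l + r - m - 1))"
  define F1 where "F1 = (\<lambda>r l. P l * Q r * e r l)"
  define F2 where "F2 = (\<lambda>r l. P r * Q l * e r l)"
  have e: "y ^ nat a * y ^ nat b = y ^ nat (a + b)" if "0 \<le> a" "0 \<le> b" for a b
    using that by (simp add: nat_add_distrib power_add)
  have box1: "(\<Sum>r=1..k. \<Sum>l=m + 1..k. F1 r l) = g * (\<Sum>l=m + 1..k. P l * y ^ nat (l - m - 1))"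
    unfolding g_def sum_product
  proof (intro sum.cong refl)
    fix r l assume "r \<in> {1..k}" "l \<in> {m + 1..k}"
    then have "y ^ nat r * y ^ nat (l - m - 1) = e r l"
      by (subst e) (auto simp: e_def algebra_simps)
    then show "F1 r l = Q r * y ^ nat r * (P l * y ^ nat (l - m - 1))"
      unfolding F1_def by (metis (no_types, lifting) mult.commute mult.left_commute)
  qed
  have box2: "(\<Sum>r=1..k. \<Sum>l=m + 1..k. F2 r l) = p * (\<Sum>l=m + 1..k. Q l * y ^ nat (l - m))"
    unfolding p_def sum_product
  proof (intro sum.cong refl)
    fix r l assume "r \<in> {1..k}" "l \<in> {m + 1..k}"
    then have "y ^ nat (r - 1) * y ^ nat (l - m) = e r l"
      by (subst e) (auto simp: e_def algebra_simps)
    then show "F2 r l = P r * y ^ nat (r - 1) * (Q l * y ^ nat (l - m))"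
      unfolding F2_def by (metis (no_types, lifting) mult.commute mult.left_commute)
  qed
  have "(\<Sum>r=m + 1..k. \<Sum>l=m + 1..k. if l + r > m + k then F1 r l else 0) =
      (\<Sum>l=m + 1..k. \<Sum>r=m + 1..k. if l + r > m + k then F1 r l else 0)"
    by (rule sum.swap)
  also have "\<dots> = (\<Sum>r=m + 1..k. \<Sum>l=m + 1..k. if l + r > m + k then F2 r l else 0)"
    by (intro sum.cong refl) (auto simp: F1_def F2_def e_def add.commute)
  finally have balance: "g * (\<Sum>l=m + 1..k. P l * y ^ nat (l - m - 1))
        - (\<Sum>i=0..k - 1. \<Sum>r=1..i. F1 r (m + i + 1 - r)) =
      p * (\<Sum>l=m + 1..k. Q l * y ^ nat (l - m))
        - (\<Sum>i=0..k - 1. \<Sum>r=1..i. F2 r (m + i + 1 - r))"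
    using box_sum_split[of k F1 m] box_sum_split[of k F2 m] m
    unfolding box1[symmetric] box2[symmetric] by (simp add: F1_def F2_def P Q)
  have t1: "(\<Sum>i=0..k - 1. y ^ nat i * P (m + i + 1)) = (\<Sum>l=m + 1..k. P l * y ^ nat (l - m - 1))"
  proof -
    have "(\<Sum>i=0..k - 1. y ^ nat i * P (m + i + 1)) = (\<Sum>l=m + 1..m + k. P l * y ^ nat (l - m - 1))"
      by (rule sum.reindex_bij_witness[where i = "\<lambda>l. l - m - 1" and j = "\<lambda>i. m + i + 1"]) auto
    also have "\<dots> = (\<Sum>l=m + 1..k. P l * y ^ nat (l - m - 1))"
      using m by (intro sum.mono_neutral_right) (auto simp: P)
    finally show ?thesis .
  qed
  have t2: "(\<Sum>i=0..k - 1. y ^ nat i * P (i + 1)) = p"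
    unfolding p_def
    by (rule sum.reindex_bij_witness[where i = "\<lambda>l. l - 1" and j = "\<lambda>i. i + 1"]) auto
  have H: "(\<Sum>l=m..k. Q l * y ^ nat (l - m)) = Q m + (\<Sum>l=m + 1..k. Q l * y ^ nat (l - m))"
  proof -
    have "{m..k} = insert m {m + 1..k}"
      using m by auto
    then show ?thesis by simp
  qed
  have "(\<Sum>i=0..k - 1. y ^ nat i * lift_bracket P Q g m i) =
      g * (\<Sum>i=0..k - 1. y ^ nat i * P (m + i + 1))
      - (\<Sum>i=0..k - 1. \<Sum>r=1..i. F1 r (m + i + 1 - r))
      + (\<Sum>i=0..k - 1. \<Sum>r=1..i. F2 r (m + i + 1 - r))
      + (\<Sum>i=0..k - 1. y ^ nat i * P (i + 1)) * Q m"
    unfolding lift_bracket_def F1_def F2_def e_def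
    by (simp add: sum.distrib sum_subtractf sum_distrib_left sum_distrib_right algebra_simps)
  also have "\<dots> = p * (\<Sum>l=m..k. Q l * y ^ nat (l - m))"
    unfolding t1 t2 H using balance by (simp add: algebra_simps)
  finally show ?thesis
    unfolding g_def p_def .
qed

text \<open>This matches the absence of a coordinate \<open>U_{k-1}\<close>: the generating identity
  runs up to \<open>i = k - 1\<close>, the \<open>A\<close>-components only up to
  \<open>k - 2\<close>. The reflection \<open>r \<mapsto> m + k - r\<close> carries the first sum to
  the second plus the term \<open>P k * Q m\<close>, which the last term of the bracket
  cancels.\<close>

lemma lift_bracket_last:
  fixes P Q :: "int \<Rightarrow> 'a::comm_ring_1"
  assumes P: "\<And>r. r > k \<Longrightarrow> P r = 0" and Q: "\<And>r. r \<ge> k \<Longrightarrow> Q r = 0"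
    and m: "1 \<le> m" "m \<le> k - 1"
  shows "lift_bracket P Q w m (k - 1) = 0"
proof -
  have "(\<Sum>r=1..k - 1. P (m + k - r) * Q r) = (\<Sum>r=m..k - 1. P (m + k - r) * Q r)"
    using m by (intro sum.mono_neutral_right) (auto simp: P)
  also have "\<dots> = (\<Sum>r=m + 1..k. P r * Q (m + k - r))"
    by (rule sum.reindex_bij_witness[where i = "\<lambda>r. m + k - r" and j = "\<lambda>r. m + k - r"]) auto
  also have "{m + 1..k} = insert k {m + 1..k - 1}"
    using m by auto
  also have "(\<Sum>r\<in>insert k {m + 1..k - 1}. P r * Q (m + k - r)) =
      P k * Q m + (\<Sum>r=m + 1..k - 1. P r * Q (m + k - r))"
    by simp
  also have "(\<Sum>r=m + 1..k - 1. P r * Q (m + k - r)) = (\<Sum>r=1..k - 1. P r * Q (m + k - r))"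
    using m by (intro sum.mono_neutral_left) (auto simp: Q)
  finally show ?thesis
    using m by (simp add: lift_bracket_def P)
qed

subsection \<open>Polynomial maps\<close>

text \<open>The map, the field and the lift are all polynomial. Generating this class inductively
  lets derivatives and finite Taylor expansions be built by structural induction, which serves both
  kinds of regularity.\<close>

inductive polyfun :: "('a::real_normed_field ^ 'n::finite \<Rightarrow> 'a) \<Rightarrow> bool" where
  const: "polyfun (\<lambda>x. c)"
| coord: "polyfun (\<lambda>x. x $ i)"
| add: "polyfun p \<Longrightarrow> polyfun q \<Longrightarrow> polyfun (\<lambda>x. p x + q x)"
| mult: "polyfun p \<Longrightarrow> polyfun q \<Longrightarrow> polyfun (\<lambda>x. p x * q x)"

lemma polyfun_uminus: "polyfun p \<Longrightarrow> polyfun (\<lambda>x. - p x)"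
  using polyfun.mult[OF polyfun.const[of "-1"], of p] by simp

lemma polyfun_diff: "polyfun p \<Longrightarrow> polyfun q \<Longrightarrow> polyfun (\<lambda>x. p x - q x)"
  using polyfun.add[OF _ polyfun_uminus, of p q] by simp

lemma polyfun_sum: "(\<And>i. i \<in> I \<Longrightarrow> polyfun (f i)) \<Longrightarrow> polyfun (\<lambda>x. \<Sum>i\<in>I. f i x)"
  by (induction I rule: infinite_finite_induct) (auto intro: polyfun.intros)

lemma polyfun_power: "polyfun p \<Longrightarrow> polyfun (\<lambda>x. p x ^ n)"
  by (induction n) (auto intro: polyfun.intros)

lemma polyfun_if: "polyfun p \<Longrightarrow> polyfun q \<Longrightarrow> polyfun (\<lambda>x. if b then p x else q x)"
  by (cases b) simp_all

lemmas polyfun_intros = polyfun.intros polyfun_uminus polyfun_diff polyfun_sum polyfun_power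

lemma polyfun_compose:
  "polyfun p \<Longrightarrow> (\<And>i. polyfun (\<lambda>x. f x $ i)) \<Longrightarrow> polyfun (\<lambda>x. p (f x))"
  by (induction rule: polyfun.induct) (auto intro: polyfun.intros)

text \<open>Directional derivatives stay in the class, which drives the induction on the order of
  differentiability. Homogeneity is carried along because \<open>has_derivative\<close> yields only
  real linearity.\<close>

lemma polyfun_has_derivative:
  assumes "polyfun p"
  obtains D where "\<And>x. (p has_derivative D x) (at x)" "\<And>v. polyfun (\<lambda>x. D x v)"
    "\<And>x c v. D x (c *s v) = c * D x v"
proof -
  from assms have "\<exists>D. (\<forall>x. (p has_derivative D x) (at x)) \<and> (\<forall>v. polyfun (\<lambda>x. D x v)) \<and>
    (\<forall>x c v. D x (c *s v) = c * D x v)"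
  proof induction
    case (const c)
    show ?case
      by (rule exI[of _ "\<lambda>_ _. 0"]) (auto intro: polyfun.intros)
  next
    case (coord i)
    show ?case
      by (rule exI[of _ "\<lambda>_ v. v $ i"])
        (auto intro: polyfun.intros bounded_linear_imp_has_derivative bounded_linear_vec_nth)
  next
    case (add p q)
    then obtain D E where "\<And>x. (p has_derivative D x) (at x)" "\<And>v. polyfun (\<lambda>x. D x v)"
      "\<And>x c v. D x (c *s v) = c * D x v" "\<And>x. (q has_derivative E x) (at x)"
      "\<And>v. polyfun (\<lambda>x. E x v)" "\<And>x c v. E x (c *s v) = c * E x v"
      by blast
    then show ?case
      by (intro exI[of _ "\<lambda>x v. D x v + E x v"])
        (auto intro!: polyfun.intros has_derivative_add simp: algebra_simps)
  next
    case (mult p q)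
    then obtain D E where "\<And>x. (p has_derivative D x) (at x)" "\<And>v. polyfun (\<lambda>x. D x v)"
      "\<And>x c v. D x (c *s v) = c * D x v" "\<And>x. (q has_derivative E x) (at x)"
      "\<And>v. polyfun (\<lambda>x. E x v)" "\<And>x c v. E x (c *s v) = c * E x v"
      by blast
    with mult.hyps show ?case
      by (intro exI[of _ "\<lambda>x v. p x * E x v + D x v * q x"])
        (auto intro!: polyfun.intros has_derivative_mult simp: distrib_left mult.left_commute mult.assoc)
  qed
  then show thesis using that by blast
qed

text \<open>A vector-valued map is the sum of its components composed with the bounded linear
  embeddings \<open>axis i\<close>.\<close>

lemma has_derivative_vec_componentwise:
  fixes f :: "'b::real_normed_vector \<Rightarrow> 'a::real_normed_vector ^ 'm::finite"
  assumes "\<And>i. ((\<lambda>x. f x $ i) has_derivative (\<lambda>v. D v $ i)) F"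
  shows "(f has_derivative D) F"
proof -
  have ax: "bounded_linear (axis i :: 'a \<Rightarrow> 'a ^ 'm)" for i
  proof (rule bounded_linear_intro[where K = 1])
    show "norm (axis i x :: 'a ^ 'm) \<le> norm x * 1" for x :: 'a
      by (simp add: norm_vec_def L2_set_def axis_def if_distrib[of "\<lambda>z. norm z ^ 2"] cong: if_cong)
  qed (auto simp: axis_def vec_eq_iff)
  have decomp: "(\<Sum>i\<in>UNIV. axis i (w $ i)) = w" for w :: "'a ^ 'm"
    by (simp add: vec_eq_iff axis_def if_distrib cong: if_cong)
  have "((\<lambda>x. \<Sum>i\<in>UNIV. axis i (f x $ i)) has_derivative (\<lambda>v. \<Sum>i\<in>UNIV. axis i (D v $ i))) F"
    by (intro has_derivative_sum bounded_linear.has_derivative[OF ax] assms)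
  then show ?thesis
    by (simp add: decomp)
qed

lemma polyfun_imp_K_Cn_on:
  fixes f :: "'a::real_normed_field ^ 'n::finite \<Rightarrow> 'a ^ 'm::finite"
  assumes "\<And>i. polyfun (\<lambda>x. f x $ i)"
  shows "K_Cn_on n S f"
  using assms
proof (induction n arbitrary: f)
  case (0 f)
  have "continuous_on S (\<lambda>x. f x $ i)" for i
    using polyfun_has_derivative[OF 0[of i]]
    by (metis continuous_at_imp_continuous_on has_derivative_continuous)
  then have "continuous_on S (\<lambda>x. \<chi> i. f x $ i)"
    by (rule continuous_on_vec_lambda)
  then show ?case by simp
next
  case (Suc n f)
  have "\<forall>i. \<exists>D. (\<forall>x. ((\<lambda>x. f x $ i) has_derivative D x) (at x)) \<and>
      (\<forall>v. polyfun (\<lambda>x. D x v)) \<and> (\<forall>x c v. D x (c *s v) = c * D x v)"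
    using polyfun_has_derivative[OF Suc.prems] by metis
  then obtain D where D: "\<And>i x. ((\<lambda>x. f x $ i) has_derivative D i x) (at x)"
    "\<And>i v. polyfun (\<lambda>x. D i x v)" "\<And>i x c v. D i x (c *s v) = c * D i x v"
    by metis
  have der: "(f has_derivative (\<lambda>v. \<chi> i. D i x v)) (at x)" for x
    by (rule has_derivative_vec_componentwise) (simp add: D(1))
  then have fd: "frechet_derivative f (at x) = (\<lambda>v. \<chi> i. D i x v)" for x
    by (metis frechet_derivative_at)
  show ?case
    using der by (auto simp: K_differentiable_on_def fd D vec_eq_iff intro!: Suc.IH
        intro: differentiableI)
qed

section \<open>Finite power series of polynomial functions\<close>

lemma polyfun_expansion:
  fixes a :: "'a::real_normed_field ^ 'n::finite"
  assumes "polyfun p"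
  obtains A and c :: "('n \<Rightarrow> nat) \<Rightarrow> 'a" where "finite A" "\<And>\<alpha>. \<alpha> \<notin> A \<Longrightarrow> c \<alpha> = 0"
    "\<And>x. p x = (\<Sum>\<alpha>\<in>A. (\<Prod>i\<in>UNIV. (x $ i - a $ i) ^ \<alpha> i) * c \<alpha>)"
proof -
  define mon :: "'a ^ 'n \<Rightarrow> ('n \<Rightarrow> nat) \<Rightarrow> 'a"
    where "mon = (\<lambda>x \<alpha>. \<Prod>i\<in>UNIV. (x $ i - a $ i) ^ \<alpha> i)"
  have mon_add: "mon x (\<lambda>i. \<alpha> i + \<beta> i) = mon x \<alpha> * mon x \<beta>" for x \<alpha> \<beta>
    by (simp add: mon_def power_add prod.distrib)
  \<comment> \<open>A finite sum of monomials with possibly repeated exponents is regrouped over the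
    fibres of \<open>\<mu>\<close>. The index type is left free: the four cases below use the unit
    type, \<open>bool\<close>, a disjoint sum and a product.\<close>
  have collect: "\<exists>A c. finite A \<and> (\<forall>\<alpha>. \<alpha> \<notin> A \<longrightarrow> c \<alpha> = 0) \<and> (\<forall>x. q x = (\<Sum>\<alpha>\<in>A. mon x \<alpha> * c \<alpha>))"
    if J: "finite J" and q: "\<And>x. q x = (\<Sum>j\<in>J. mon x (\<mu> j) * d j)"
    for q and J :: "'j set" and \<mu> d
  proof (intro exI conjI allI impI)
    show "finite (\<mu> ` J)" using J by simp
    show "(\<Sum>j\<in>{j\<in>J. \<mu> j = \<alpha>}. d j) = 0" if "\<alpha> \<notin> \<mu> ` J" for \<alpha>
      using that by (intro sum.neutral) auto
    show "q x = (\<Sum>\<alpha>\<in>\<mu> ` J. mon x \<alpha> * (\<Sum>j\<in>{j\<in>J. \<mu> j = \<alpha>}. d j))" for x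
      unfolding q sum.image_gen[OF J, of "\<lambda>j. mon x (\<mu> j) * d j" \<mu>]
      by (intro sum.cong refl) (auto simp: sum_distrib_left)
  qed
  from assms have "\<exists>A c. finite A \<and> (\<forall>\<alpha>. \<alpha> \<notin> A \<longrightarrow> c \<alpha> = 0) \<and> (\<forall>x. p x = (\<Sum>\<alpha>\<in>A. mon x \<alpha> * c \<alpha>))"
  proof induction
    case (const c)
    show ?case
      by (rule collect[of "{()}" _ "\<lambda>_ _. 0" "\<lambda>_. c"]) (auto simp: mon_def)
  next
    case (coord i)
    \<comment> \<open>The coordinate is written as \<open>(x $ i - a $ i) + a $ i\<close>;
      \<open>True\<close> indexes the linear term and \<open>False\<close> the constant one.\<close>
    have "mon x (\<lambda>l. if l = i then 1 else 0) = x $ i - a $ i" for x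
      by (simp add: mon_def if_distrib[of "\<lambda>n. _ ^ n"] cong: if_cong)
    moreover have "mon x (\<lambda>_. 0) = 1" for x
      by (simp add: mon_def)
    ultimately show ?case
      by (intro collect[of "UNIV :: bool set" _ "\<lambda>b l. if b \<and> l = i then 1 else 0"
            "\<lambda>b. if b then 1 else a $ i"]) (auto simp: UNIV_bool)
  next
    case (add p q)
    then obtain A c B d where *: "finite A" "finite B"
      "\<And>x. p x = (\<Sum>\<alpha>\<in>A. mon x \<alpha> * c \<alpha>)" "\<And>x. q x = (\<Sum>\<alpha>\<in>B. mon x \<alpha> * d \<alpha>)"
      by blast
    show ?case
      by (rule collect[of "A <+> B" _ "case_sum id id" "case_sum c d"])
        (auto simp: * sum.Plus o_def)
  next
    case (mult p q)
    then obtain A c B d where *: "finite A" "finite B"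
      "\<And>x. p x = (\<Sum>\<alpha>\<in>A. mon x \<alpha> * c \<alpha>)" "\<And>x. q x = (\<Sum>\<alpha>\<in>B. mon x \<alpha> * d \<alpha>)"
      by blast
    show ?case
      by (rule collect[of "A \<times> B" _ "\<lambda>(\<alpha>, \<beta>) i. \<alpha> i + \<beta> i" "\<lambda>(\<alpha>, \<beta>). c \<alpha> * d \<beta>"])
        (auto simp: * mon_add sum_product sum.cartesian_product algebra_simps intro!: sum.cong)
  qed
  then show thesis
    using that unfolding mon_def by blast
qed

text \<open>The expansion at every point is a finite sum, so it converges everywhere and any
  positive radius serves.\<close>

lemma polyfun_imp_K_analytic_on:
  fixes f :: "'a::real_normed_field ^ 'n::finite \<Rightarrow> 'a ^ 'm::finite"
  assumes "\<And>i. polyfun (\<lambda>x. f x $ i)"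
  shows "K_analytic_on S f"
  unfolding K_analytic_on_def
proof
  fix a assume "a \<in> S"
  let ?mon = "\<lambda>x \<alpha>. \<Prod>i\<in>UNIV. (x $ i - a $ i) ^ \<alpha> i"
  have "\<exists>A c. finite A \<and> (\<forall>\<alpha>. \<alpha> \<notin> A \<longrightarrow> c \<alpha> = 0) \<and>
      (\<forall>x. f x $ i = (\<Sum>\<alpha>\<in>A. ?mon x \<alpha> * c \<alpha>))" for i
    by (rule polyfun_expansion[OF assms[of i], of a]) blast
  then have "\<exists>A. \<forall>i. \<exists>c. finite (A i) \<and> (\<forall>\<alpha>. \<alpha> \<notin> A i \<longrightarrow> c \<alpha> = 0) \<and>
      (\<forall>x. f x $ i = (\<Sum>\<alpha>\<in>A i. ?mon x \<alpha> * c \<alpha>))"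
    by (intro choice allI)
  then obtain A where "\<exists>c. \<forall>i. finite (A i) \<and> (\<forall>\<alpha>. \<alpha> \<notin> A i \<longrightarrow> c i \<alpha> = 0) \<and>
      (\<forall>x. f x $ i = (\<Sum>\<alpha>\<in>A i. ?mon x \<alpha> * c i \<alpha>))"
    by (elim exE) (drule choice, blast)
  then obtain c where A: "\<And>i. finite (A i)" and c: "\<And>i \<alpha>. \<alpha> \<notin> A i \<Longrightarrow> c i \<alpha> = 0"
    and f: "\<And>i x. f x $ i = (\<Sum>\<alpha>\<in>A i. ?mon x \<alpha> * c i \<alpha>)"
    by blast
  \<comment> \<open>The components have different finite supports. Their union serves all of them,
    since each coefficient vanishes outside its own support.\<close>
  define B where "B = (\<Union>i\<in>UNIV. A i)"
  have "finite B"
    using A by (simp add: B_def)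
  have "((\<lambda>\<alpha>. ?mon x \<alpha> *s (\<chi> i. c i \<alpha>)) has_sum f x) UNIV" for x
  proof (rule has_sum_finite_neutralI[of B])
    show "f x = (\<Sum>\<alpha>\<in>B. ?mon x \<alpha> *s (\<chi> i. c i \<alpha>))"
      unfolding vec_eq_iff
    proof
      fix i
      have "(\<Sum>\<alpha>\<in>A i. ?mon x \<alpha> * c i \<alpha>) = (\<Sum>\<alpha>\<in>B. ?mon x \<alpha> * c i \<alpha>)"
        using \<open>finite B\<close> c by (intro sum.mono_neutral_left) (auto simp: B_def)
      then show "f x $ i = (\<Sum>\<alpha>\<in>B. ?mon x \<alpha> *s (\<chi> i. c i \<alpha>)) $ i"
        by (simp add: f)
    qed
  qed (use \<open>finite B\<close> c in \<open>auto simp: B_def vec_eq_iff\<close>)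
  then show "\<exists>c r. r > 0 \<and> (\<forall>x\<in>ball a r. ((\<lambda>\<alpha>. ?mon x \<alpha> *s c \<alpha>) has_sum f x) UNIV)"
    by (intro exI[of _ "\<lambda>\<alpha>. \<chi> i. c i \<alpha>"] exI[of _ 1]) simp
qed

lemma polyfun_imp_regular_germ:
  assumes "\<And>i. polyfun (\<lambda>x. f x $ i)"
  shows "regular_germ reg f"
proof -
  have "regular_on reg UNIV f"
    using polyfun_imp_K_Cn_on[OF assms] polyfun_imp_K_analytic_on[OF assms]
    by (cases reg) (simp_all add: K_smooth_on_def)
  then show ?thesis
    unfolding regular_germ_def by blast
qed

subsection \<open>Coordinates and the lift\<close>

lemma vec_of_list_nth:
  assumes "inj_on e {..<length xs}" "p < length xs"
  shows "vec_of_list e xs $ e p = xs ! p"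
  using assms by (simp add: vec_of_list_def inv_into_f_f)

lemma sum_int_eq_sum_nat: "(\<Sum>r=1..int n. h r) = (\<Sum>i=1..n. h (int i))"
  by (rule sum.reindex_bij_witness[where i = int and j = nat]) auto

text \<open>This is the shape of the last two rows of the lifting equation: \<open>- c * a i\<close>
  comes from the lifted \<open>u\<close>- or \<open>v\<close>-components, and
  \<open>c * (d i * z)\<close> from the \<open>y\<close>-component \<open>c * z\<close>.\<close>

lemma sum_combine:
  fixes c z :: "'a::comm_ring_1"
  shows "(\<Sum>i\<in>I. - c * a i + c * (d i * z)) = c * ((\<Sum>i\<in>I. d i) * z - (\<Sum>i\<in>I. a i))"
  by (simp add: sum.distrib sum_subtractf sum_negf right_diff_distrib sum_distrib_left sum_distrib_right)

section \<open>The components of the field as brackets\<close>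

lemma A3_eq_lift_bracket:
  "A3 k U V (w :: 'a::comm_ring_1) i j = - of_int k * lift_bracket (\<lambda>r. of_int r * U r) V w (k - j) i"
proof -
  have index: "k + i - j - r + 1 = k - j + i + 1 - r" "k + i - j + 1 = k - j + i + 1" for r
    by simp_all
  have factor: "- c * a * u * z + c * S1 - c * S2 - c * b * q * v =
      - c * (a * u * z - S1 + S2 + b * q * v)" for a b c u z S1 S2 q v :: 'a
    by (simp add: algebra_simps)
  show ?thesis
    unfolding A3_def lift_bracket_def index by (rule factor)
qed

lemma B3_eq_lift_bracket:
  "B3 k V (w :: 'a::comm_ring_1) i j = - of_int k * lift_bracket (\<lambda>r. of_int r * V r) V w (k - j) i"
proof -
  have index: "k + i - j - r + 1 = k - j + i + 1 - r" "k + i - j + 1 = k - j + i + 1"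
    "k + i - j - 2 * r + 1 = k - j + i + 1 - 2 * r" for r
    by simp_all
  have factor: "- c * a * u * z + c * (S1 - S2) - c * b * q * v =
      - c * (a * u * z - S1 + S2 + b * q * v)" for a b c u z S1 S2 q v :: 'a
    by (simp add: algebra_simps)
  \<comment> \<open>Splitting the coefficient as \<open>(a - r) - r\<close> separates the single sum
    of \<open>B3\<close> into the two sums of the bracket.\<close>
  have term_diff: "of_int (a - 2 * r) * v * u = of_int (a - r) * u * v - of_int r * v * u"
    for a r and u v :: 'a
    by (simp add: algebra_simps)
  have "(\<Sum>r=1..i. of_int (k - j + i + 1 - 2 * r) * V r * V (k - j + i + 1 - r)) =
      (\<Sum>r=1..i. of_int (k - j + i + 1 - r) * V (k - j + i + 1 - r) * V r)
      - (\<Sum>r=1..i. of_int r * V r * V (k - j + i + 1 - r))"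
    unfolding sum_subtractf[symmetric] by (intro sum.cong refl term_diff)
  then have "B3 k V w i j =
      - of_int k * of_int (k - j + i + 1) * V (k - j + i + 1) * w
      + of_int k * ((\<Sum>r=1..i. of_int (k - j + i + 1 - r) * V (k - j + i + 1 - r) * V r)
        - (\<Sum>r=1..i. of_int r * V r * V (k - j + i + 1 - r)))
      - of_int k * of_int (i + 1) * V (i + 1) * V (k - j)"
    unfolding B3_def index by (simp only:)
  then show ?thesis
    unfolding lift_bracket_def by (rule trans) (rule factor)
qed

text \<open>Both sums are empty at \<open>i = 0\<close>. The sign is opposite to that of
  \<open>A3\<close>, because the terms with \<open>i \<ge> 1\<close> cancel in the lifting equation
  and leave the constant one.\<close>

lemma C3_1_eq_lift_bracket:
  "C3_1 k U V w j = of_int k * lift_bracket (\<lambda>r. of_int r * U r) V w (k - j) 0"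
  unfolding C3_1_def lift_bracket_def by (simp add: algebra_simps)

lemma C3_2_eq_lift_bracket:
  "C3_2 k V w j = of_int k * lift_bracket (\<lambda>r. of_int r * V r) V w (k - j) 0"
  unfolding C3_2_def lift_bracket_def by (simp add: algebra_simps)

text \<open>The field of scalars is not fixed here, so the results apply to both real and complex
  spaces. The first \<open>2 * k - 3\<close> positions of source and target correspond; the source
  then has \<open>y\<close>, the target \<open>W_1\<close> and \<open>W_2\<close>.\<close>

locale cross_cap_coords =
  fixes k :: nat and s :: "nat \<Rightarrow> 'n::finite" and t :: "nat \<Rightarrow> 'm::finite"
  assumes k_ge_2: "k \<ge> 2"
    and s_bij: "bij_betw s {..<2 * k - 2} UNIV"
    and t_bij: "bij_betw t {..<2 * k - 1} UNIV"
begin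

lemma source_index_cases:
  obtains p where "p < 2 * k - 3" "i = s p" | "i = s (2 * k - 3)"
proof -
  have "i \<in> s ` {..<2 * k - 2}"
    using s_bij by (simp add: bij_betw_def)
  then obtain p where "p < 2 * k - 2" "i = s p"
    by auto
  moreover from this have "p < 2 * k - 3 \<or> p = 2 * k - 3"
    by linarith
  ultimately show thesis
    using that by blast
qed

lemma target_index_cases:
  obtains p where "p < 2 * k - 3" "i = t p" | "i = t (2 * k - 3)" | "i = t (2 * k - 2)"
proof -
  have "i \<in> t ` {..<2 * k - 1}"
    using t_bij by (simp add: bij_betw_def)
  then obtain p where "p < 2 * k - 1" "i = t p"
    by auto
  moreover from this have "p < 2 * k - 3 \<or> p = 2 * k - 3 \<or> p = 2 * k - 2"
    by linarith
  ultimately show thesis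
    using that by blast
qed

lemma vec_of_list_source:
  "length xs = 2 * k - 2 \<Longrightarrow> p < 2 * k - 2 \<Longrightarrow> vec_of_list s xs $ s p = xs ! p"
  using s_bij by (intro vec_of_list_nth) (simp_all add: bij_betw_def)

lemma vec_of_list_target:
  "length xs = 2 * k - 1 \<Longrightarrow> p < 2 * k - 1 \<Longrightarrow> vec_of_list t xs $ t p = xs ! p"
  using t_bij by (intro vec_of_list_nth) (simp_all add: bij_betw_def)

section \<open>Coordinates of the map and of the field\<close>

lemma min_cross_cap_nth:
  assumes "p < 2 * k - 3"
  shows "min_cross_cap k s t x $ t p = x $ s p"
  unfolding min_cross_cap_def Let_def using assms k_ge_2
  by (subst vec_of_list_target) (auto simp: nth_append)

lemma min_cross_cap_W1:
  "min_cross_cap k s t x $ t (2 * k - 3) =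
    x $ s (2 * k - 3) ^ k + (\<Sum>i=1..k - 2. x $ s (i - 1) * x $ s (2 * k - 3) ^ i)"
  unfolding min_cross_cap_def Let_def using k_ge_2
  by (subst vec_of_list_target) (auto simp: nth_append)

lemma min_cross_cap_W2:
  "min_cross_cap k s t x $ t (2 * k - 2) =
    (\<Sum>i=1..k - 1. x $ s (k - 2 + (i - 1)) * x $ s (2 * k - 3) ^ i)"
proof -
  have "2 * k - 2 - (2 * k - 3) = 1"
    using k_ge_2 by linarith
  then show ?thesis
    unfolding min_cross_cap_def Let_def using k_ge_2
    by (subst vec_of_list_target) (auto simp: nth_append)
qed

lemma xi3_A:
  assumes "1 \<le> i" "i \<le> k - 2"
  shows "xi3 k t j X $ t (i - 1) =
    A3 (int k) (U_coord k t X) (V_coord k t X) (W2_coord k t X) (int i) (int j)"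
  unfolding xi3_def Let_def using assms k_ge_2
  by (subst vec_of_list_target) (auto simp: nth_append)

lemma xi3_B:
  assumes "1 \<le> i" "i \<le> k - 1"
  shows "xi3 k t j X $ t (k - 2 + (i - 1)) =
    B3 (int k) (V_coord k t X) (W2_coord k t X) (int i) (int j)"
  unfolding xi3_def Let_def using assms k_ge_2
  by (subst vec_of_list_target) (auto simp: nth_append)

lemma xi3_C1:
  "xi3 k t j X $ t (2 * k - 3) =
    C3_1 (int k) (U_coord k t X) (V_coord k t X) (W2_coord k t X) (int j)"
  unfolding xi3_def Let_def using k_ge_2
  by (subst vec_of_list_target) (auto simp: nth_append)

lemma xi3_C2:
  "xi3 k t j X $ t (2 * k - 2) = C3_2 (int k) (V_coord k t X) (W2_coord k t X) (int j)"
proof -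
  have "2 * k - 2 - (2 * k - 3) = 1"
    using k_ge_2 by linarith
  then show ?thesis
    unfolding xi3_def Let_def using k_ge_2
    by (subst vec_of_list_target) (auto simp: nth_append)
qed

section \<open>The derivative of the map\<close>

definition min_cross_cap_deriv :: "'a::real_normed_field ^ 'n \<Rightarrow> 'a ^ 'n \<Rightarrow> 'a ^ 'm" where
  "min_cross_cap_deriv x h =
     (let y = x $ s (2 * k - 3); dy = h $ s (2 * k - 3)
      in vec_of_list t (map (\<lambda>p. h $ s p) [0..<2 * k - 3] @
        [of_nat k * y ^ (k - 1) * dy + (\<Sum>i=1..k - 2.
           h $ s (i - 1) * y ^ i + x $ s (i - 1) * (of_nat i * y ^ (i - 1) * dy)),
         \<Sum>i=1..k - 1. h $ s (k - 2 + (i - 1)) * y ^ i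
           + x $ s (k - 2 + (i - 1)) * (of_nat i * y ^ (i - 1) * dy)]))"

lemma min_cross_cap_deriv_nth:
  assumes "p < 2 * k - 3"
  shows "min_cross_cap_deriv x h $ t p = h $ s p"
  unfolding min_cross_cap_deriv_def Let_def using assms
  by (subst vec_of_list_target) (auto simp: nth_append)

lemma min_cross_cap_deriv_W1:
  "min_cross_cap_deriv x h $ t (2 * k - 3) =
    of_nat k * x $ s (2 * k - 3) ^ (k - 1) * h $ s (2 * k - 3) + (\<Sum>i=1..k - 2.
      h $ s (i - 1) * x $ s (2 * k - 3) ^ i
      + x $ s (i - 1) * (of_nat i * x $ s (2 * k - 3) ^ (i - 1) * h $ s (2 * k - 3)))"
  unfolding min_cross_cap_deriv_def Let_def using k_ge_2
  by (subst vec_of_list_target) (auto simp: nth_append)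

lemma min_cross_cap_deriv_W2:
  "min_cross_cap_deriv x h $ t (2 * k - 2) = (\<Sum>i=1..k - 1.
      h $ s (k - 2 + (i - 1)) * x $ s (2 * k - 3) ^ i
      + x $ s (k - 2 + (i - 1)) * (of_nat i * x $ s (2 * k - 3) ^ (i - 1) * h $ s (2 * k - 3)))"
proof -
  have "2 * k - 2 - (2 * k - 3) = 1"
    using k_ge_2 by linarith
  then show ?thesis
    unfolding min_cross_cap_deriv_def Let_def using k_ge_2
    by (subst vec_of_list_target) (auto simp: nth_append)
qed

lemma min_cross_cap_has_derivative:
  "(min_cross_cap k s t has_derivative min_cross_cap_deriv x) (at x)"
proof (rule has_derivative_vec_componentwise)
  fix c
  have coord: "((\<lambda>x. x $ i) has_derivative (\<lambda>h. h $ i)) (at x)" for i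
    by (intro bounded_linear_imp_has_derivative bounded_linear_vec_nth)
  have pow: "((\<lambda>x. x $ i ^ n) has_derivative (\<lambda>h. of_nat n * x $ i ^ (n - 1) * h $ i)) (at x)" for i n
    by (rule has_derivative_eq_rhs[OF has_derivative_power[OF coord]]) (simp add: ac_simps)
  have prod: "((\<lambda>x. x $ l * x $ i ^ n) has_derivative
      (\<lambda>h. h $ l * x $ i ^ n + x $ l * (of_nat n * x $ i ^ (n - 1) * h $ i))) (at x)" for l i n
    by (rule has_derivative_eq_rhs[OF has_derivative_mult[OF coord pow]]) (simp add: add.commute)
  show "((\<lambda>x. min_cross_cap k s t x $ c) has_derivative (\<lambda>h. min_cross_cap_deriv x h $ c)) (at x)"
  proof (cases c rule: target_index_cases)
    case (1 p)
    then show ?thesis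
      by (simp add: min_cross_cap_nth min_cross_cap_deriv_nth coord)
  next
    case 2
    show ?thesis
      unfolding 2 min_cross_cap_W1 min_cross_cap_deriv_W1
      by (intro has_derivative_add has_derivative_sum pow prod)
  next
    case 3
    show ?thesis
      unfolding 3 min_cross_cap_W2 min_cross_cap_deriv_W2
      by (intro has_derivative_sum prod)
  qed
qed

section \<open>Polynomiality of the map and of the field\<close>

lemma polyfun_min_cross_cap: "polyfun (\<lambda>x. min_cross_cap k s t x $ c)"
proof (cases c rule: target_index_cases)
  case (1 p)
  then show ?thesis
    by (simp add: min_cross_cap_nth polyfun.coord)
next
  case 2
  show ?thesis
    unfolding 2 min_cross_cap_W1 by (intro polyfun_intros)
next
  case 3
  show ?thesis
    unfolding 3 min_cross_cap_W2 by (intro polyfun_intros)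
qed

lemma polyfun_U_coord: "polyfun (\<lambda>X. U_coord k t X r)"
  unfolding U_coord_def by (intro polyfun_if polyfun_intros)

lemma polyfun_V_coord: "polyfun (\<lambda>X. V_coord k t X r)"
  unfolding V_coord_def by (intro polyfun_if polyfun_intros)

lemma polyfun_W2_coord: "polyfun (\<lambda>X. W2_coord k t X)"
  unfolding W2_coord_def by (intro polyfun_intros)

lemmas polyfun_coord_intros = polyfun_U_coord polyfun_V_coord polyfun_W2_coord

lemma polyfun_xi3: "polyfun (\<lambda>X. xi3 k t j X $ c)"
proof (cases c rule: target_index_cases)
  case (1 p)
  show ?thesis
  proof (cases "p < k - 2")
    case True
    then have "xi3 k t j X $ c = A3 (int k) (U_coord k t X) (V_coord k t X) (W2_coord k t X)
        (int (p + 1)) (int j)" for X :: "'a ^ 'm"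
      using xi3_A[of "p + 1" j X] 1 by simp
    then show ?thesis
      unfolding A3_def by (simp only:) (intro polyfun_coord_intros polyfun_intros)
  next
    case False
    \<comment> \<open>Positions from \<open>k - 2\<close> on belong to \<open>V\<close>; the index
      of \<open>V\<close> at position \<open>p\<close> is \<open>p - (k - 2) + 1\<close>.\<close>
    then have "k - 2 + (p - (k - 2) + 1 - 1) = p" "p - (k - 2) + 1 \<le> k - 1"
      using 1 by linarith+
    then have "xi3 k t j X $ c = B3 (int k) (V_coord k t X) (W2_coord k t X)
        (int (p - (k - 2) + 1)) (int j)" for X :: "'a ^ 'm"
      using xi3_B[of "p - (k - 2) + 1" j X] 1(2) by (simp only:)
    then show ?thesis
      unfolding B3_def by (simp only:) (intro polyfun_coord_intros polyfun_intros)
  qed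
next
  case 2
  show ?thesis
    unfolding 2 xi3_C1 C3_1_def by (intro polyfun_coord_intros polyfun_intros)
next
  case 3
  show ?thesis
    unfolding 3 xi3_C2 C3_2_def by (intro polyfun_coord_intros polyfun_intros)
qed

text \<open>All entries but the last are forced, since the map copies these coordinates. The last is
  \<open>k\<close> times the polynomial part of \<open>q(y) / y^m\<close> for
  \<open>m = k - j\<close>, where \<open>q(y)\<close> is the last component of the map.\<close>

definition xi3_lift :: "nat \<Rightarrow> 'a::real_normed_field ^ 'n \<Rightarrow> 'a ^ 'n" where
  "xi3_lift j x =
     (let X = min_cross_cap k s t x
      in vec_of_list s (map (\<lambda>p. xi3 k t j X $ t p) [0..<2 * k - 3] @
        [of_nat k * (\<Sum>l=int k - int j..int k.
           V_coord k t X l * x $ s (2 * k - 3) ^ nat (l - (int k - int j)))]))"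

lemma xi3_lift_nth:
  assumes "p < 2 * k - 3"
  shows "xi3_lift j x $ s p = xi3 k t j (min_cross_cap k s t x) $ t p"
  unfolding xi3_lift_def Let_def using assms
  by (subst vec_of_list_source) (auto simp: nth_append)

lemma xi3_lift_y:
  "xi3_lift j x $ s (2 * k - 3) = of_nat k * (\<Sum>l=int k - int j..int k.
     V_coord k t (min_cross_cap k s t x) l * x $ s (2 * k - 3) ^ nat (l - (int k - int j)))"
  unfolding xi3_lift_def Let_def using k_ge_2
  by (subst vec_of_list_source) (auto simp: nth_append)

lemma polyfun_xi3_lift: "polyfun (\<lambda>x. xi3_lift j x $ c)"
proof (cases c rule: source_index_cases)
  case (1 p)
  then show ?thesis
    by (simp add: xi3_lift_nth polyfun_compose[OF polyfun_xi3 polyfun_min_cross_cap])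
next
  case 2
  show ?thesis
    unfolding 2 xi3_lift_y
    by (intro polyfun_intros polyfun_compose[OF polyfun_V_coord polyfun_min_cross_cap])
qed

text \<open>The copied rows hold by construction. With \<open>b i\<close> the bracket, the row of
  \<open>W_1\<close> is \<open>k\<close> times \<open>p' H\<close> minus the sum of the
  \<open>y ^ i * b i\<close> with \<open>i \<ge> 1\<close>; by the generating identity this is
  \<open>k * b 0\<close>, the required component. The row of \<open>W_2\<close> is analogous with
  \<open>q'\<close>.\<close>

lemma min_cross_cap_deriv_xi3_lift:
  assumes j: "1 \<le> j" "j \<le> k - 1"
  shows "min_cross_cap_deriv x (xi3_lift j x) = xi3 k t j (min_cross_cap k s t x)"
  unfolding vec_eq_iff
proof
  fix c
  define X where "X = min_cross_cap k s t x"
  define U where "U = U_coord k t X"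
  define V where "V = V_coord k t X"
  define w where "w = W2_coord k t X"
  define y where "y = x $ s (2 * k - 3)"
  define m where "m = int k - int j"
  define H where "H = (\<Sum>l=m..int k. V l * y ^ nat (l - m))"
  have m: "1 \<le> m" "m \<le> int k - 1"
    using j by (auto simp: m_def)
  have U: "U (int i) = x $ s (i - 1)" if "1 \<le> i" "i \<le> k - 2" for i
  proof -
    have "int i \<le> int k - 2" "i - 1 < 2 * k - 3"
      using that by linarith+
    then show ?thesis
      using that(1) by (simp add: U_def U_coord_def X_def min_cross_cap_nth)
  qed
  have V: "V (int i) = x $ s (k - 2 + (i - 1))" if "1 \<le> i" "i \<le> k - 1" for i
  proof -
    have "int i \<le> int k - 1" "k - 2 + (i - 1) < 2 * k - 3"
      using that by linarith+
    then show ?thesis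
      using that(1) by (simp add: V_def V_coord_def X_def min_cross_cap_nth)
  qed
  have Uk: "U (int k) = 1" "U (int k - 1) = 0"
    using k_ge_2 by (auto simp: U_def U_coord_def)
  have U_gt: "U r = 0" if "r > int k" for r
    using that by (auto simp: U_def U_coord_def)
  have Vk: "V r = 0" if "r \<ge> int k" for r
    using that by (auto simp: V_def V_coord_def)
  have w: "w = (\<Sum>r=1..int k. V r * y ^ nat r)"
  proof -
    have "w = (\<Sum>i=1..k - 1. V (int i) * y ^ i)"
      by (simp add: w_def W2_coord_def X_def min_cross_cap_W2 V y_def)
    \<comment> \<open>The range is extended to \<open>k\<close>, as the generating identity expects,
      using \<open>V_k = 0\<close>.\<close>
    also have "\<dots> = (\<Sum>i=1..k. V (int i) * y ^ i)"
      by (intro sum.mono_neutral_left) (auto simp: Vk not_le)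
    finally show ?thesis
      by (simp add: sum_int_eq_sum_nat)
  qed
  have y_comp: "xi3_lift j x $ s (2 * k - 3) = of_nat k * H"
    by (simp add: xi3_lift_y H_def V_def X_def y_def m_def)
  have u_comp: "xi3_lift j x $ s (i - 1) = - of_nat k * lift_bracket (\<lambda>r. of_int r * U r) V w m (int i)"
    if "1 \<le> i" "i \<le> k - 2" for i
  proof -
    have "i - 1 < 2 * k - 3"
      using that by linarith
    from xi3_lift_nth[OF this, of j x] xi3_A[OF that, of j X] show ?thesis
      by (simp only: A3_eq_lift_bracket U_def V_def w_def m_def X_def of_int_of_nat_eq)
  qed
  have v_comp: "xi3_lift j x $ s (k - 2 + (i - 1)) =
      - of_nat k * lift_bracket (\<lambda>r. of_int r * V r) V w m (int i)"
    if "1 \<le> i" "i \<le> k - 1" for i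
  proof -
    have "k - 2 + (i - 1) < 2 * k - 3"
      using that by linarith
    from xi3_lift_nth[OF this, of j x] xi3_B[OF that, of j X] show ?thesis
      by (simp only: B3_eq_lift_bracket V_def w_def m_def X_def of_int_of_nat_eq)
  qed
  \<comment> \<open>The generating identity with its term \<open>i = 0\<close> split off, for a
    general \<open>P\<close> so that it covers both \<open>U\<close> and \<open>V\<close>.\<close>
  have lift: "(\<Sum>i=1..k. of_int i * P (int i) * y ^ (i - 1)) * H =
      lift_bracket (\<lambda>r. of_int r * P r) V w m 0
      + (\<Sum>i=1..k - 1. y ^ i * lift_bracket (\<lambda>r. of_int r * P r) V w m (int i))"
    if "\<And>r. r > int k \<Longrightarrow> P r = 0" for P
  proof -
    have "(\<Sum>i=1..k. of_int i * P (int i) * y ^ (i - 1)) * H =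
        (\<Sum>i=0..int k - 1. y ^ nat i * lift_bracket (\<lambda>r. of_int r * P r) V w m i)"
      unfolding w H_def
      by (subst sum_lift_bracket)
        (use m that Vk in \<open>auto simp: sum_int_eq_sum_nat nat_diff_distrib\<close>)
    also have "{0..int k - 1} = insert 0 {1..int (k - 1)}"
      using k_ge_2 by auto
    finally show ?thesis
      by (simp add: sum_int_eq_sum_nat)
  qed
  show "min_cross_cap_deriv x (xi3_lift j x) $ c = xi3 k t j (min_cross_cap k s t x) $ c"
  proof (cases c rule: target_index_cases)
    case (1 p)
    then show ?thesis
      by (simp add: min_cross_cap_deriv_nth xi3_lift_nth)
  next
    case 2
    let ?b = "lift_bracket (\<lambda>r. of_int r * U r) V w m"
    let ?d = "\<lambda>i. of_int (int i) * U (int i) * y ^ (i - 1)"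
    \<comment> \<open>The convention \<open>U_k = 1\<close> supplies the derivative of the leading
      term \<open>y ^ k\<close>, and \<open>U_{k-1} = 0\<close> removes the missing power.\<close>
    have "(\<Sum>i=1..k. ?d i) = of_nat k * y ^ (k - 1) + (\<Sum>i=1..k - 2. ?d i)"
    proof -
      have "(\<Sum>i=1..k. ?d i) = (\<Sum>i\<in>insert k {1..k - 2}. ?d i)"
      proof (intro sum.mono_neutral_right ballI)
        fix i assume "i \<in> {1..k} - insert k {1..k - 2}"
        then have "int i = int k - 1"
          by auto
        then show "?d i = 0"
          by (simp only: Uk) simp
      qed (use k_ge_2 in auto)
      then show ?thesis
        using k_ge_2 by (simp add: Uk)
    qed
    \<comment> \<open>The bracket at \<open>k - 1\<close> has no \<open>u\<close>-component to match
      it, but it vanishes.\<close>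
    moreover have "(\<Sum>i=1..k - 1. y ^ i * ?b (int i)) = (\<Sum>i=1..k - 2. y ^ i * ?b (int i))"
    proof -
      have "?b (int k - 1) = 0"
        using U_gt Vk m by (intro lift_bracket_last) simp_all
      moreover have "int (k - 1) = int k - 1"
        using k_ge_2 by simp
      moreover have "{1..k - 1} = insert (k - 1) {1..k - 2}"
        using k_ge_2 by auto
      ultimately show ?thesis
        by (simp add: sum.insert_if)
    qed
    ultimately have *: "(of_nat k * y ^ (k - 1) + (\<Sum>i=1..k - 2. ?d i)) * H =
        ?b 0 + (\<Sum>i=1..k - 2. y ^ i * ?b (int i))"
      using lift[of U] U_gt by simp
    have "min_cross_cap_deriv x (xi3_lift j x) $ c = of_nat k * y ^ (k - 1) * (of_nat k * H)
        + (\<Sum>i=1..k - 2. - of_nat k * (y ^ i * ?b (int i)) + of_nat k * (?d i * H))"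
      unfolding 2 min_cross_cap_deriv_W1 y_comp y_def[symmetric]
    proof (intro arg_cong2[of _ _ _ _ "(+)", OF refl] sum.cong[OF refl])
      fix i assume "i \<in> {1..k - 2}"
      then show "xi3_lift j x $ s (i - 1) * y ^ i
            + x $ s (i - 1) * (of_nat i * y ^ (i - 1) * (of_nat k * H)) =
          - of_nat k * (y ^ i * ?b (int i)) + of_nat k * (?d i * H)"
        using u_comp[of i] U[of i] by (simp add: mult_ac)
    qed
    also have "\<dots> = of_nat k * ((of_nat k * y ^ (k - 1) + (\<Sum>i=1..k - 2. ?d i)) * H
        - (\<Sum>i=1..k - 2. y ^ i * ?b (int i)))"
      unfolding sum_combine by (simp add: algebra_simps)
    also have "\<dots> = of_nat k * ?b 0"
      unfolding * by simp
    also have "\<dots> = xi3 k t j (min_cross_cap k s t x) $ c"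
      unfolding 2 xi3_C1 C3_1_eq_lift_bracket U_def V_def w_def m_def X_def by simp
    finally show ?thesis .
  next
    case 3
    let ?b = "lift_bracket (\<lambda>r. of_int r * V r) V w m"
    let ?d = "\<lambda>i. of_int (int i) * V (int i) * y ^ (i - 1)"
    \<comment> \<open>Here \<open>V_k = 0\<close> drops the top term, and each of the
      \<open>k - 1\<close> remaining brackets is matched by a \<open>v\<close>-component.\<close>
    have "(\<Sum>i=1..k. ?d i) = (\<Sum>i=1..k - 1. ?d i)"
      by (intro sum.mono_neutral_right) (auto simp: Vk not_le)
    then have *: "(\<Sum>i=1..k - 1. ?d i) * H = ?b 0 + (\<Sum>i=1..k - 1. y ^ i * ?b (int i))"
      using lift[of V] Vk by simp
    have "min_cross_cap_deriv x (xi3_lift j x) $ c =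
        (\<Sum>i=1..k - 1. - of_nat k * (y ^ i * ?b (int i)) + of_nat k * (?d i * H))"
      unfolding 3 min_cross_cap_deriv_W2 y_comp y_def[symmetric]
    proof (intro sum.cong[OF refl])
      fix i assume "i \<in> {1..k - 1}"
      then show "xi3_lift j x $ s (k - 2 + (i - 1)) * y ^ i
            + x $ s (k - 2 + (i - 1)) * (of_nat i * y ^ (i - 1) * (of_nat k * H)) =
          - of_nat k * (y ^ i * ?b (int i)) + of_nat k * (?d i * H)"
        using v_comp[of i] V[of i] by (simp add: mult_ac)
    qed
    also have "\<dots> = of_nat k * ((\<Sum>i=1..k - 1. ?d i) * H - (\<Sum>i=1..k - 1. y ^ i * ?b (int i)))"
      by (rule sum_combine)
    also have "\<dots> = of_nat k * ?b 0"
      unfolding * by simp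
    also have "\<dots> = xi3 k t j (min_cross_cap k s t x) $ c"
      unfolding 3 xi3_C2 C3_2_eq_lift_bracket V_def w_def m_def X_def by simp
    finally show ?thesis .
  qed
qed

lemma min_cross_cap_0: "min_cross_cap k s t (0 :: 'a::real_normed_field ^ 'n) = 0"
  unfolding vec_eq_iff
proof
  fix c
  show "min_cross_cap k s t (0 :: 'a ^ 'n) $ c = 0 $ c"
    by (cases c rule: target_index_cases)
      (use k_ge_2 in \<open>simp_all add: min_cross_cap_nth min_cross_cap_W1 min_cross_cap_W2\<close>)
qed

text \<open>The lifting equation holds at every point of the source, hence near the origin, and
  polynomiality gives either kind of regularity.\<close>

lemma liftable_xi3:
  assumes "1 \<le> j" "j \<le> k - 1"
  shows "liftable reg (min_cross_cap k s t :: 'a::real_normed_field ^ 'n \<Rightarrow> 'a ^ 'm) (xi3 k t j)"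
proof -
  have "frechet_derivative (min_cross_cap k s t) (at x) (xi3_lift j x) =
      xi3 k t j (min_cross_cap k s t x)" for x :: "'a ^ 'n"
    using min_cross_cap_has_derivative[of x] min_cross_cap_deriv_xi3_lift[OF assms, of x]
    by (metis frechet_derivative_at)
  then show ?thesis
    unfolding liftable_def map_germ_def vector_field_germ_def
    by (auto intro!: exI[of _ "xi3_lift j"] polyfun_imp_regular_germ polyfun_min_cross_cap
        polyfun_xi3 polyfun_xi3_lift min_cross_cap_0)
qed

end

theorem theorem3p3:
  fixes k j :: nat and reg :: regularity
    and s :: "nat \<Rightarrow> 'n::finite" and t :: "nat \<Rightarrow> 'm::finite"
  assumes "k \<ge> 2"
    and "bij_betw s {..<2 * k - 2} UNIV"
    and "bij_betw t {..<2 * k - 1} UNIV"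
    and "1 \<le> j" and "j \<le> k - 1"
  shows "liftable reg (min_cross_cap k s t :: real ^ 'n \<Rightarrow> real ^ 'm) (xi3 k t j) \<and>
         liftable reg (min_cross_cap k s t :: complex ^ 'n \<Rightarrow> complex ^ 'm) (xi3 k t j)"
proof -
  interpret cross_cap_coords k s t
    using assms by unfold_locales
  show ?thesis
    by (intro conjI liftable_xi3 assms)
qed

end
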